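(* Let $n\ge 2$, let $\Pi'_n$ be the output of the greedy algorithm described in the context, and let $\Pi_n$ be the word obtained from $\Pi'_n$ by deleting its last $n-1$ letters and taking the reduced form of the result. Then $\Pi_n$, regarded as a cyclic word, is a universal cycle (u-cycle) for $n$-permutations: every permutation of $\{1,\dots,n\}$ is the reduced form of exactly one cyclic factor of length $n$ of $\Pi_n$.
   Context: For a word $w$ of distinct integers, $\mathrm{red}(w)$ denotes the word obtained by replacing the $i$-th smallest entry of $w$ by $i$. A factor of a word is a block of consecutive letters; in a cyclic word $c_1\cdots c_N$, the cyclic factors of length $n$ are $c_jc_{j+1}\cdots c_{j+n-1}$ for $1\le j\le N$, indices taken modulo $N$. Extensions: for a word $\pi=\pi_1\cdots\pi_m$ of distinct integers and $1\le i\le m$, the $i$-th extension of $\pi$ is $c_b(\pi_1)\cdots c_b(\pi_m)\,b$, where $b$ is the $i$-th smallest element of $\{\pi_1,\dots,\pi_m\}$ and $c_b(x)=x$ if $x<b$, $c_b(x)=x+1$ if $x\ge b$. The $(m+1)$-st extension of $\pi$ is $\pi b$ with $b=\max_j\pi_j+1$. Greedy algorithm: start with $\Pi'_{n,0}=12\cdots(n-1)$. Given $\Pi'_{n,k}=a_1a_2\cdots a_{k+n-1}$ (a permutation of $\{1,\dots,k+n-1\}$ in which no two factors of length $n$ have the same reduced form), let $i\in\{1,\dots,n\}$ be minimal such that the $i$-th extension of $a_{k+1}\cdots a_{k+n-1}$ has reduced form different from the reduced form of every length-$n$ factor of $\Pi'_{n,k}$, let $b$ be the last element of this extension, and set $\Pi'_{n,k+1}=c_b(a_1)\cdots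 c_b(a_{k+n-1})\,b$. If no such $i$ exists, the algorithm terminates and outputs $\Pi'_n:=\Pi'_{n,k}$. *)

theory Defs
  imports "HOL-Library.While_Combinator" "HOL-Combinatorics.Multiset_Permutations"
begin

definition red :: "int list \<Rightarrow> int list" where
  "red w = map (\<lambda>x. int (card {y \<in> set w. y \<le> x})) w"

definition factors :: "nat \<Rightarrow> int list \<Rightarrow> int list set" where
  "factors n w = {take n (drop j w) | j. j + n \<le> length w}"

(* 0-based starting position j *)
definition cyclic_factor :: "nat \<Rightarrow> int list \<Rightarrow> nat \<Rightarrow> int list" where
  "cyclic_factor n w j = map (\<lambda>t. w ! ((j + t) mod length w)) [0..<n]"

(* The quantifier ranges over starting positions, so "exactly one" counts
   occurrences of cyclic factors. *)
definition universal_cycle :: "nat \<Rightarrow> int list \<Rightarrow> bool" where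
  "universal_cycle n w \<longleftrightarrow>
     (\<forall>\<sigma> \<in> permutations_of_set {1..int n}.
        \<exists>!j. j < length w \<and> red (cyclic_factor n w j) = \<sigma>)"

definition bump :: "int \<Rightarrow> int \<Rightarrow> int" where
  "bump b x = (if x < b then x else x + 1)"

definition append_letter :: "int \<Rightarrow> int list \<Rightarrow> int list" where
  "append_letter b w = map (bump b) w @ [b]"

(* Meaningful for 1 \<le> i \<le> length w + 1; the else branch is the case i = length w + 1. *)
definition extension :: "nat \<Rightarrow> int list \<Rightarrow> int list" where
  "extension i w =
     (if i \<le> length w then append_letter (sorted_list_of_set (set w) ! (i - 1)) w
      else w @ [Max (set w) + 1])"

definition last_letters :: "nat \<Rightarrow> int list \<Rightarrow> int list" where
  "last_letters m w = drop (length w - m) w"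

definition admissible :: "nat \<Rightarrow> int list \<Rightarrow> nat \<Rightarrow> bool" where
  "admissible n w i \<longleftrightarrow> 1 \<le> i \<and> i \<le> n \<and>
     red (extension i (last_letters (n - 1) w)) \<notin> red ` factors n w"

definition greedy_step :: "nat \<Rightarrow> int list \<Rightarrow> int list" where
  "greedy_step n w =
     (let i = (LEAST i. admissible n w i);
          b = last (extension i (last_letters (n - 1) w))
      in append_letter b w)"

(* None if the algorithm does not terminate. *)
definition greedy_output :: "nat \<Rightarrow> int list option" where
  "greedy_output n =
     while_option (\<lambda>w. \<exists>i. admissible n w i) (greedy_step n) [1..int n - 1]"

definition cycle_word :: "nat \<Rightarrow> int list \<Rightarrow> int list" where
  "cycle_word n w = red (take (length w - (n - 1)) w)"

end

theory Submission
  imports Defs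
begin

text \<open>
  The algorithm walks in the graph whose vertices are the \<open>(n-1)\<close>-permutations and whose edges are
  the \<open>n\<close>-permutations \<open>\<sigma>\<close>, leading from the pattern of the first \<open>n-1\<close> letters of \<open>\<sigma>\<close> to that of
  the last \<open>n-1\<close> letters. Every vertex has \<open>n\<close> outgoing and \<open>n\<close> incoming edges, so the walk can only
  get stuck at its starting vertex \<open>12\<dots>(n-1)\<close>, all of whose edges are then used. The greedy choice
  takes the edge appending a new maximum last; hence, if that edge is used at a vertex, all edges at the
  vertex are used. As appending maxima leads from any vertex to \<open>12\<dots>(n-1)\<close>, the walk is Eulerian.

  It remains to close up the word. The last \<open>n-1\<close> steps are last exits, so each of the last \<open>n-1\<close>
  letters is the maximum of the length-\<open>n\<close> window it ends. On the other hand, the first \<open>n-1\<close> letters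
  are increasing and exceed all later letters: the first \<open>n-1\<close> steps append new minima, and
  afterwards the new letter is at most one above the maximum of a window lying below the first letter.
  Hence replacing the last \<open>n-1\<close> letters by the first \<open>n-1\<close> letters preserves all patterns.
\<close>

section \<open>Reduced forms\<close>

lemma bump_strict_mono: "strict_mono (bump b)"
  by (auto simp: strict_mono_def bump_def)

lemma card_le_strict_mono_on:
  fixes S :: "int set"
  assumes "finite S"
  shows "strict_mono_on S (\<lambda>x. int (card {y \<in> S. y \<le> x}))"
proof (rule strict_mono_onI)
  fix r s assume rs: "r \<in> S" "s \<in> S" "r < s"
  have "{y \<in> S. y \<le> r} \<subset> {y \<in> S. y \<le> s}"
  proof (rule psubsetI)
    show "{y \<in> S. y \<le> r} \<subseteq> {y \<in> S. y \<le> s}" using rs by auto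
    have "s \<in> {y \<in> S. y \<le> s}" "s \<notin> {y \<in> S. y \<le> r}" using rs by auto
    then show "{y \<in> S. y \<le> r} \<noteq> {y \<in> S. y \<le> s}" by blast
  qed
  then have "card {y \<in> S. y \<le> r} < card {y \<in> S. y \<le> s}"
    using assms by (intro psubset_card_mono) auto
  then show "int (card {y \<in> S. y \<le> r}) < int (card {y \<in> S. y \<le> s})" by simp
qed

lemma length_red [simp]: "length (red w) = length w"
  by (simp add: red_def)

lemma red_nth: "i < length w \<Longrightarrow> red w ! i = int (card {y \<in> set w. y \<le> w ! i})"
  by (simp add: red_def)

lemma red_map:
  assumes "strict_mono_on (set w) f"
  shows "red (map f w) = red w"
proof -
  have "card {y \<in> f ` set w. y \<le> f x} = card {y \<in> set w. y \<le> x}" if x: "x \<in> set w" for x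
  proof -
    have "{y \<in> f ` set w. y \<le> f x} = f ` {y \<in> set w. y \<le> x}"
      using strict_mono_on_less_eq[OF assms] x by auto
    moreover have "inj_on f {y \<in> set w. y \<le> x}"
      by (rule inj_on_subset[OF strict_mono_on_imp_inj_on[OF assms]]) auto
    ultimately show ?thesis by (simp add: card_image)
  qed
  then show ?thesis by (simp add: red_def)
qed

lemma red_map_bump [simp]: "red (map (bump b) w) = red w"
  by (rule red_map[OF monotone_on_subset[OF bump_strict_mono subset_UNIV]])

lemma red_nth_less_iff:
  assumes "i < length w" "j < length w"
  shows "red w ! i < red w ! j \<longleftrightarrow> w ! i < w ! j"
  using strict_mono_on_less[OF card_le_strict_mono_on[of "set w"]] assms
  by (simp add: red_nth)

lemma red_permutation:
  assumes "distinct w"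
  shows "red w \<in> permutations_of_set {1..int (length w)}"
proof (rule permutations_of_setI)
  have inj: "inj_on (\<lambda>x. int (card {y \<in> set w. y \<le> x})) (set w)"
    by (rule strict_mono_on_imp_inj_on[OF card_le_strict_mono_on]) simp
  show d: "distinct (red w)"
    using assms inj by (simp add: red_def distinct_map)
  have "set (red w) \<subseteq> {1..int (length w)}"
  proof
    fix r assume "r \<in> set (red w)"
    then obtain x where x: "x \<in> set w" "r = int (card {y \<in> set w. y \<le> x})"
      by (auto simp: red_def)
    have "card {y \<in> set w. y \<le> x} > 0"
      using x by (auto simp: card_gt_0_iff)
    moreover have "card {y \<in> set w. y \<le> x} \<le> length w"
      by (rule order_trans[OF card_mono[of "set w"] card_length]) auto
    ultimately show "r \<in> {1..int (length w)}" using x by simp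
  qed
  moreover have "card (set (red w)) = length w"
    using distinct_card[OF d] by simp
  ultimately show "set (red w) = {1..int (length w)}"
    by (intro card_subset_eq) auto
qed

lemma red_permutation_id:
  assumes "\<sigma> \<in> permutations_of_set {1..int n}"
  shows "red \<sigma> = \<sigma>"
proof -
  have s: "set \<sigma> = {1..int n}" using assms by (rule permutations_of_setD)
  have "int (card {y \<in> {1..int n}. y \<le> x}) = x" if "x \<in> {1..int n}" for x
  proof -
    have "{y \<in> {1..int n}. y \<le> x} = {1..x}" using that by auto
    then show ?thesis using that by simp
  qed
  then show ?thesis unfolding red_def s by (intro map_idI) (simp add: s)
qed

lemma length_permutation_int:
  "\<sigma> \<in> permutations_of_set {1..int n} \<Longrightarrow> length \<sigma> = n"
  by (simp add: length_finite_permutations_of_set)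

text \<open>Distinct entries make ranks countable over positions instead of values, and they let the
  comparison for a pair of positions be recovered from its reversal.\<close>

lemma red_eqI:
  assumes "length u = length v" "distinct u" "distinct v"
    and less: "\<And>i j. i < j \<Longrightarrow> j < length u \<Longrightarrow> u ! i < u ! j \<longleftrightarrow> v ! i < v ! j"
  shows "red u = red v"
proof (rule nth_equalityI)
  fix i assume "i < length (red u)"
  then have i: "i < length u" by simp
  have card_eq: "card {y \<in> set x. y \<le> x ! i} = card {j. j < length x \<and> x ! j \<le> x ! i}"
    if "distinct x" for x :: "int list"
  proof -
    have "{y \<in> set x. y \<le> x ! i} = (!) x ` {j. j < length x \<and> x ! j \<le> x ! i}"
      by (auto simp: in_set_conv_nth)
    moreover have "inj_on ((!) x) {j. j < length x \<and> x ! j \<le> x ! i}"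
      using that by (auto simp: inj_on_def nth_eq_iff_index_eq)
    ultimately show ?thesis by (simp add: card_image)
  qed
  have "u ! j \<le> u ! i \<longleftrightarrow> v ! j \<le> v ! i" if j: "j < length u" for j
  proof (cases i j rule: linorder_cases)
    case less
    then show ?thesis using assms(4)[of i j] j by (metis linorder_not_less)
  next
    case greater
    moreover have "u ! j \<noteq> u ! i" "v ! j \<noteq> v ! i"
      using greater i assms by (auto simp: nth_eq_iff_index_eq)
    ultimately show ?thesis using less[of j i] i by force
  qed simp
  then have "{j. j < length u \<and> u ! j \<le> u ! i} = {j. j < length v \<and> v ! j \<le> v ! i}"
    using assms(1) by auto
  then show "red u ! i = red v ! i"
    using i assms by (simp add: red_nth card_eq)
qed (use assms in simp)

text \<open>Inserting \<open>a\<close> raises by one exactly the ranks that are at least the rank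
  \<open>a\<close> receives. So adding a letter to a word acts on reduced forms through
  \<open>bump\<close>.\<close>

lemma bump_card_le:
  fixes S :: "int set"
  assumes "finite S" "a \<notin> S" "z \<in> S"
  shows "int (card {y \<in> insert a S. y \<le> z})
       = bump (1 + int (card {y \<in> S. y < a})) (int (card {y \<in> S. y \<le> z}))"
proof (cases "z < a")
  case True
  have "{y \<in> insert a S. y \<le> z} = {y \<in> S. y \<le> z}" using True by auto
  moreover have "card {y \<in> S. y \<le> z} \<le> card {y \<in> S. y < a}"
    using True assms by (intro card_mono) auto
  ultimately show ?thesis by (simp add: bump_def)
next
  case False
  then have "a < z" using assms by (metis linorder_neqE)
  then have "{y \<in> insert a S. y \<le> z} = insert a {y \<in> S. y \<le> z}" by auto
  moreover have "card (insert z {y \<in> S. y < a}) \<le> card {y \<in> S. y \<le> z}"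
    using \<open>a < z\<close> assms by (intro card_mono) auto
  ultimately show ?thesis using \<open>a < z\<close> assms by (simp add: bump_def)
qed

lemma card_le_insert_self:
  fixes S :: "int set"
  assumes "finite S" "a \<notin> S"
  shows "card {y \<in> insert a S. y \<le> a} = Suc (card {y \<in> S. y < a})"
proof -
  have "{y \<in> insert a S. y \<le> a} = insert a {y \<in> S. y < a}" using assms by force
  then show ?thesis using assms by simp
qed

text \<open>Together with \<open>red_Cons\<close> this describes edges: a pattern is coded by its
  source vertex and last rank, or by its first rank and target vertex.\<close>

lemma red_snoc:
  assumes "distinct (x @ [a])"
  shows "red (x @ [a]) = append_letter (1 + int (card {y \<in> set x. y < a})) (red x)"
  using assms bump_card_le[of "set x" a] card_le_insert_self[of "set x" a]
  by (simp add: red_def append_letter_def)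

lemma red_Cons:
  assumes "distinct (a # x)"
  shows "red (a # x) = (let c = 1 + int (card {y \<in> set x. y < a}) in c # map (bump c) (red x))"
  using assms bump_card_le[of "set x" a] card_le_insert_self[of "set x" a]
  by (simp add: red_def Let_def)

lemma distinct_append_letter:
  assumes "distinct u"
  shows "distinct (append_letter b u)"
proof -
  have "inj (bump b)" using bump_strict_mono by (rule strict_mono_imp_inj_on)
  then show ?thesis using assms
    by (auto simp: append_letter_def distinct_map bump_def intro: inj_on_subset split: if_splits)
qed

lemma red_append_letter:
  assumes "distinct u"
  shows "red (append_letter b u) = append_letter (1 + int (card {y \<in> set u. y < b})) (red u)"
proof -
  have inj: "inj (bump b)" using bump_strict_mono by (rule strict_mono_imp_inj_on)
  have "{y \<in> bump b ` set u. y < b} = bump b ` {y \<in> set u. y < b}"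
    by (auto simp: bump_def split: if_splits)
  then have "card {y \<in> bump b ` set u. y < b} = card {y \<in> set u. y < b}"
    using inj by (simp add: card_image inj_on_subset)
  then show ?thesis
    using red_snoc[of "map (bump b) u" b] distinct_append_letter[OF assms, of b]
    by (simp add: append_letter_def)
qed

lemma card_less_sorted_nth:
  fixes S :: "int set"
  assumes "finite S" "k < card S"
  shows "card {y \<in> S. y < sorted_list_of_set S ! k} = k"
proof -
  let ?l = "sorted_list_of_set S"
  have len: "length ?l = card S" and d: "distinct ?l" and s: "sorted_wrt (<) ?l" and S: "set ?l = S"
    using assms by auto
  have "{y \<in> S. y < ?l ! k} = (!) ?l ` {..<k}"
  proof (intro equalityI subsetI)
    fix y assume "y \<in> {y \<in> S. y < ?l ! k}"
    then obtain j where j: "j < card S" "y = ?l ! j" "?l ! j < ?l ! k"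
      using S len by (metis (no_types, lifting) in_set_conv_nth mem_Collect_eq)
    have "j < k"
      using j assms s len sorted_wrt_nth_less[of "(<)" ?l k j] by (metis linorder_neqE_nat order_less_asym)
    then show "y \<in> (!) ?l ` {..<k}" using j by blast
  next
    fix y assume "y \<in> (!) ?l ` {..<k}"
    then show "y \<in> {y \<in> S. y < ?l ! k}"
      using assms s len S sorted_wrt_nth_less[of "(<)" ?l _ k]
      by (smt (verit, del_insts) imageE lessThan_iff mem_Collect_eq nth_mem order_less_trans)
  qed
  moreover have "inj_on ((!) ?l) {..<k}"
    using d len assms by (auto simp: inj_on_def nth_eq_iff_index_eq)
  ultimately show ?thesis by (simp add: card_image)
qed

section \<open>Extensions\<close>

lemma append_letter_above:
  assumes "\<forall>x \<in> set u. x < b"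
  shows "append_letter b u = u @ [b]"
  using assms by (auto simp: append_letter_def bump_def intro!: map_idI)

text \<open>The top extension fits the general form because a letter above the maximum bumps
  nothing.\<close>

lemma extension_eq_append_letter:
  "extension i u = append_letter (last (extension i u)) u"
proof (cases "i \<le> length u")
  case True
  then show ?thesis by (simp add: extension_def append_letter_def)
next
  case False
  have "\<forall>x \<in> set u. x < Max (set u) + 1" by (simp add: zle_add1_eq_le)
  then show ?thesis using False append_letter_above by (simp add: extension_def)
qed

lemma card_less_last_extension:
  assumes "distinct u" "1 \<le> i" "i \<le> Suc (length u)"
  shows "1 + int (card {y \<in> set u. y < last (extension i u)}) = int i"
proof (cases "i \<le> length u")
  case True
  then show ?thesis using assms card_less_sorted_nth[of "set u" "i - 1"]
    by (simp add: extension_def append_letter_def distinct_card)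
next
  case False
  have "{y \<in> set u. y < Max (set u) + 1} = set u" by (auto simp: zle_add1_eq_le)
  then show ?thesis using False assms by (simp add: extension_def distinct_card)
qed

lemma red_extension:
  assumes "distinct u" "1 \<le> i" "i \<le> Suc (length u)"
  shows "red (extension i u) = append_letter (int i) (red u)"
  by (subst extension_eq_append_letter)
    (simp only: red_append_letter[OF assms(1)] card_less_last_extension[OF assms])

lemma last_extension_le:
  assumes "u \<noteq> []" "1 \<le> i" "\<forall>x \<in> set u. x < c" "distinct u"
  shows "last (extension i u) \<le> c"
proof (cases "i \<le> length u")
  case True
  then have "sorted_list_of_set (set u) ! (i - 1) \<in> set (sorted_list_of_set (set u))"
    using assms by (intro nth_mem) (simp add: distinct_card)
  then show ?thesis using assms True by (auto simp: extension_def append_letter_def)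
next
  case False
  have "Max (set u) < c" using assms by simp
  then show ?thesis using False by (simp add: extension_def)
qed

lemma last_extension_1_le:
  assumes "x \<in> set u"
  shows "last (extension 1 u) \<le> x"
proof -
  let ?l = "sorted_list_of_set (set u)"
  obtain j where j: "j < length ?l" "x = ?l ! j"
    using assms by (metis List.finite_set in_set_conv_nth set_sorted_list_of_set)
  have "?l ! 0 \<le> x" using j by (auto intro: sorted_nth_mono)
  moreover have "1 \<le> length u" using assms by (cases u) auto
  ultimately show ?thesis by (simp add: extension_def append_letter_def)
qed

lemma append_letter_inject:
  "append_letter i u = append_letter j v \<longleftrightarrow> i = j \<and> u = v"
  using strict_mono_imp_inj_on[OF bump_strict_mono, of j]
  by (auto simp: append_letter_def inj_map_eq_map)

lemma Cons_map_bump_inject: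
  "i # map (bump i) u = j # map (bump j) v \<longleftrightarrow> i = j \<and> u = v"
  using strict_mono_imp_inj_on[OF bump_strict_mono, of j] by (auto simp: inj_map_eq_map)

section \<open>Patterns of factors\<close>

text \<open>With \<open>m\<close> equal to n - 1, \<open>pat m w j\<close> is the vertex of the walk
  at time \<open>j\<close>, and \<open>pat (Suc m) w j\<close> is the edge taken from there. Both
  are unaffected by later bumps.\<close>

definition pat :: "nat \<Rightarrow> int list \<Rightarrow> nat \<Rightarrow> int list" where
  "pat l w j = red (take l (drop j w))"

lemma pat_permutation:
  assumes "distinct w" "j + l \<le> length w"
  shows "pat l w j \<in> permutations_of_set {1..int l}"
proof -
  have "length (take l (drop j w)) = l" using assms by simp
  then show ?thesis
    using red_permutation[of "take l (drop j w)"] assms unfolding pat_def by simp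
qed

lemma pat_append_letter:
  assumes "j + l \<le> length w"
  shows "pat l (append_letter b w) j = pat l w j"
  using assms by (simp add: pat_def append_letter_def take_map drop_map)

lemma pat_append_letter_last:
  assumes "length w = k + m"
  shows "pat (Suc m) (append_letter b w) k = red (append_letter b (drop k w))"
  using assms by (simp add: pat_def append_letter_def drop_map)

lemma pat_Suc_snoc:
  assumes "distinct w" "j + Suc m \<le> length w"
  shows "pat (Suc m) w j = append_letter (last (pat (Suc m) w j)) (pat m w j)"
proof -
  have eq: "take (Suc m) (drop j w) = take m (drop j w) @ [w ! (j + m)]"
    using assms by (simp add: take_Suc_conv_app_nth)
  have "distinct (take (Suc m) (drop j w))" using assms by simp
  then have "distinct (take m (drop j w) @ [w ! (j + m)])" unfolding eq .
  from red_snoc[OF this] show ?thesis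
    unfolding pat_def eq by (simp add: append_letter_def)
qed

lemma pat_Suc_Cons:
  assumes "distinct w" "j + Suc m \<le> length w"
  shows "pat (Suc m) w j = hd (pat (Suc m) w j) # map (bump (hd (pat (Suc m) w j))) (pat m w (Suc j))"
proof -
  have eq: "take (Suc m) (drop j w) = w ! j # take m (drop (Suc j) w)"
    using assms by (metis Cons_nth_drop_Suc Suc_leD add_leD1 le_add1 le_add_same_cancel1
        less_le_trans nat_less_le not_less_eq_eq take_Suc_Cons add_Suc_right)
  have "distinct (take (Suc m) (drop j w))" using assms by simp
  then have "distinct (w ! j # take m (drop (Suc j) w))" unfolding eq .
  from red_Cons[OF this] show ?thesis
    unfolding pat_def eq by (simp add: Let_def)
qed

lemma pat_nth_less_iff:
  assumes "j + l \<le> length w" "s < l" "t < l"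
  shows "pat l w j ! s < pat l w j ! t \<longleftrightarrow> w ! (j + s) < w ! (j + t)"
  using red_nth_less_iff[of s "take l (drop j w)" t] assms by (simp add: pat_def)

lemma pat_eq_nth_less_iff:
  assumes "pat l w i = pat l w j" "i + l \<le> length w" "j + l \<le> length w" "s < l" "t < l"
  shows "w ! (i + s) < w ! (i + t) \<longleftrightarrow> w ! (j + s) < w ! (j + t)"
  using pat_nth_less_iff[of i l w s t] pat_nth_less_iff[of j l w s t] assms by simp

lemma image_red_factors:
  "red ` factors (Suc m) w = pat (Suc m) w ` {..<length w - m}"
proof -
  have "j + Suc m \<le> length w \<longleftrightarrow> j < length w - m" for j by auto
  then show ?thesis by (auto simp: factors_def pat_def image_iff)
qed

lemma pat_upto_increasing:
  assumes "pat l w j = [1..int l]" "j + l \<le> length w" "s < t" "t < l"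
  shows "w ! (j + s) < w ! (j + t)"
  using pat_nth_less_iff[of j l w s t] assms by (simp add: nth_upto)

section \<open>The invariant of the greedy algorithm\<close>

text \<open>The invariant describes a trail: \<open>inj\<close> forbids repeated edges, and
  \<open>greedy\<close> says that smaller labels at the current vertex were used at earlier times.
  \<open>start\<close> and \<open>below\<close> prepare the cyclic closure.\<close>

locale greedy_word =
  fixes m :: nat and w :: "int list"
  assumes m_pos: "0 < m"
    and distinct_w: "distinct w"
    and length_w: "m \<le> length w"
    and start: "pat m w 0 = [1..int m]"
    and inj: "inj_on (pat (Suc m) w) {..<length w - m}"
    and greedy: "\<And>j i. \<lbrakk>j < length w - m; 1 \<le> i; i < last (pat (Suc m) w j)\<rbrakk>
      \<Longrightarrow> append_letter i (pat m w j) \<in> pat (Suc m) w ` {..<j}"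
    and below: "\<And>q. \<lbrakk>m \<le> q; q < length w\<rbrakk> \<Longrightarrow> w ! q < w ! 0"
begin

abbreviation k :: nat where "k \<equiv> length w - m"

lemma start_increasing:
  assumes "i < j" "j < m"
  shows "w ! i < w ! j"
  using pat_upto_increasing[OF start, of i j] assms length_w by simp

lemma admissible_iff:
  "admissible (Suc m) w i \<longleftrightarrow> 1 \<le> i \<and> i \<le> Suc m \<and>
     append_letter (int i) (pat m w k) \<notin> pat (Suc m) w ` {..<k}"
proof -
  have "red (extension i (drop k w)) = append_letter (int i) (pat m w k)"
    if "1 \<le> i" "i \<le> Suc m"
    using that distinct_w length_w by (simp add: red_extension pat_def)
  then show ?thesis
    unfolding admissible_def last_letters_def image_red_factors diff_Suc_1 by metis
qed

text \<open>The first \<open>m\<close> vertices visited are told apart by the position of their first descent, so the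
  first \<open>m\<close> steps all append a new minimum.\<close>

lemma early_admissible:
  assumes "k < m"
  shows "admissible (Suc m) w 1"
proof -
  have "append_letter 1 (pat m w k) \<noteq> pat (Suc m) w j" if j: "j < k" for j
  proof
    assume "append_letter 1 (pat m w k) = pat (Suc m) w j"
    then have "pat m w k = pat m w j"
      using pat_Suc_snoc[OF distinct_w, of j m] j append_letter_inject
      by (metis less_diff_conv add_Suc_right Suc_leI)
    \<comment> \<open>In window \<open>k\<close> these offsets hit positions \<open>m - 1\<close>
      and \<open>m\<close>, a descent by \<open>below\<close>. In the earlier window
      \<open>j\<close> they stay inside the increasing start.\<close>
    then have "w ! (k + (m - 1 - k)) < w ! (k + (m - k)) \<longleftrightarrow> w ! (j + (m - 1 - k)) < w ! (j + (m - k))"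
      using j assms by (intro pat_eq_nth_less_iff) auto
    moreover have "w ! (j + (m - 1 - k)) < w ! (j + (m - k))"
      using j assms by (intro start_increasing) auto
    moreover have "k + (m - 1 - k) = m - 1" "k + (m - k) = m" using assms by auto
    ultimately have "w ! (m - 1) < w ! m" by metis
    moreover have "w ! m < w ! 0" using j by (intro below) auto
    moreover have "w ! 0 \<le> w ! (m - 1)"
      using start_increasing[of 0 "m - 1"] m_pos by (cases "m = 1") auto
    ultimately show False by simp
  qed
  then show ?thesis by (auto simp: admissible_iff)
qed

text \<open>This preserves \<open>below\<close>; equality is harmless, since the bump then lifts
  \<open>w ! 0\<close> above the new letter. While the window still meets the start, the new letter
  is a minimum of a window containing some letter at most \<open>w ! 0\<close>. Afterwards the whole
  window lies below \<open>w ! 0\<close>, so even one above its maximum is at most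
  \<open>w ! 0\<close>.\<close>

lemma greedy_letter_le:
  assumes ex: "\<exists>i. admissible (Suc m) w i"
  shows "last (extension (LEAST i. admissible (Suc m) w i) (drop k w)) \<le> w ! 0"
proof (cases "k < m")
  case True
  have "(LEAST i. admissible (Suc m) w i) = 1"
    by (rule Least_equality) (use early_admissible[OF True] admissible_iff in auto)
  moreover have "\<exists>x \<in> set (drop k w). x \<le> w ! 0"
  proof (cases "k = 0")
    case True
    then show ?thesis using length_w m_pos by (metis drop0 nth_mem order.refl order.strict_trans2)
  next
    case False
    have "last (drop k w) = w ! (length w - 1)"
      using m_pos length_w last_conv_nth[of w] by (cases "w = []") (auto simp: last_drop)
    moreover have "last (drop k w) \<in> set (drop k w)"
      using m_pos length_w by (intro last_in_set) auto
    moreover have "w ! (length w - 1) < w ! 0" using False by (intro below) auto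
    ultimately show ?thesis by (metis less_imp_le)
  qed
  ultimately show ?thesis using last_extension_1_le by (metis order_trans)
next
  case False
  show ?thesis
  proof (rule last_extension_le)
    show "drop k w \<noteq> []" using m_pos length_w by auto
    show "1 \<le> (LEAST i. admissible (Suc m) w i)"
      using LeastI_ex[OF ex] admissible_iff by blast
    show "\<forall>x \<in> set (drop k w). x < w ! 0"
      using False below by (auto simp: in_set_conv_nth)
    show "distinct (drop k w)" using distinct_w by simp
  qed
qed

lemma greedy_step_greedy_word:
  assumes ex: "\<exists>i. admissible (Suc m) w i"
  shows "greedy_word m (greedy_step (Suc m) w)"
proof -
  define i where "i = (LEAST i. admissible (Suc m) w i)"
  define b where "b = last (extension i (drop k w))"
  define w' where "w' = append_letter b w"
  have step: "greedy_step (Suc m) w = w'"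
    by (simp add: greedy_step_def w'_def b_def i_def last_letters_def Let_def)
  have adm: "admissible (Suc m) w i" unfolding i_def using ex by (rule LeastI_ex)
  then have i: "1 \<le> i" "i \<le> Suc m" by (auto simp: admissible_iff)
  have len: "length w' = Suc (length w)" by (simp add: w'_def append_letter_def)
  have old: "pat l w' j = pat l w j" if "j + l \<le> length w" for l j
    using that by (simp add: w'_def pat_append_letter)
  have new: "pat (Suc m) w' k = append_letter (int i) (pat m w k)"
  proof -
    have "pat (Suc m) w' k = red (append_letter b (drop k w))"
      unfolding w'_def using length_w by (intro pat_append_letter_last) simp
    also have "append_letter b (drop k w) = extension i (drop k w)"
      unfolding b_def by (rule extension_eq_append_letter[symmetric])
    also have "red \<dots> = append_letter (int i) (red (drop k w))"
      using i distinct_w length_w by (intro red_extension) auto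
    finally show ?thesis using length_w by (simp add: pat_def)
  qed
  have k': "length w' - m = Suc k" using len length_w by simp
  have old_image: "pat (Suc m) w' ` A = pat (Suc m) w ` A" if "A \<subseteq> {..<k}" for A
    using that old by (intro image_cong) auto
  show ?thesis unfolding step
  proof
    show "0 < m" by (rule m_pos)
    show "distinct w'" using distinct_append_letter[OF distinct_w] by (simp add: w'_def)
    show "m \<le> length w'" using len length_w by simp
    show "pat m w' 0 = [1..int m]" using old[of 0 m] start length_w by simp
    have "inj_on (pat (Suc m) w') {..<k}"
      using inj old by (auto simp: inj_on_def)
    moreover have "pat (Suc m) w' k \<notin> pat (Suc m) w' ` {..<k}"
      using adm new old_image[of "{..<k}"] by (simp add: admissible_iff)
    ultimately show "inj_on (pat (Suc m) w') {..<length w' - m}"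
      by (simp add: k' lessThan_Suc)
    show "append_letter r (pat m w' j) \<in> pat (Suc m) w' ` {..<j}"
      if j: "j < length w' - m" and r: "1 \<le> r" "r < last (pat (Suc m) w' j)" for j r
    proof (cases "j = k")
      case True
      \<comment> \<open>The last entry of the new edge is its label \<open>i\<close>, so minimality
        of \<open>i\<close> rejects every smaller label.\<close>
      then have "r < int i" using r new by (simp add: append_letter_def)
      then have "nat r < i" using r by simp
      then have "\<not> admissible (Suc m) w (nat r)"
        unfolding i_def by (rule not_less_Least)
      then have "append_letter r (pat m w k) \<in> pat (Suc m) w ` {..<k}"
        using r i \<open>nat r < i\<close> by (auto simp: admissible_iff)
      then show ?thesis using True old_image old[of k m] length_w by auto
    next
      case False
      then have "j < k" using j k' by simp
      then show ?thesis using greedy[of j r] r old[of j m] old[of j "Suc m"] old_image[of "{..<j}"]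
        by auto
    qed
    show "w' ! q < w' ! 0" if q: "m \<le> q" "q < length w'" for q
    proof -
      have "0 < length w" using m_pos length_w by (rule less_le_trans)
      then have w'0: "w' ! 0 = bump b (w ! 0)"
        by (simp add: w'_def append_letter_def nth_append)
      show ?thesis
      proof (cases "q = length w")
        case True
        have "b \<le> w ! 0" using greedy_letter_le[OF ex] by (simp add: b_def i_def)
        moreover have "w' ! q = b" using True by (simp add: w'_def append_letter_def nth_append)
        ultimately show ?thesis using w'0 by (simp add: bump_def)
      next
        case False
        then have "q < length w" using q len by simp
        moreover from this have "w' ! q = bump b (w ! q)"
          by (simp add: w'_def append_letter_def nth_append)
        ultimately show ?thesis using w'0 below q bump_strict_mono
          by (simp add: strict_mono_less)
      qed
    qed
  qed
qed

lemma image_pat_permutations: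
  "pat (Suc m) w ` {..<k} \<subseteq> permutations_of_set {1..int (Suc m)}"
  using pat_permutation[OF distinct_w] by (auto simp del: of_nat_Suc)

lemma k_le_fact: "k \<le> fact (Suc m)"
proof -
  have "card (pat (Suc m) w ` {..<k}) \<le> card (permutations_of_set {1..int (Suc m)})"
    by (intro card_mono image_pat_permutations) auto
  then show ?thesis using inj by (simp add: card_image del: of_nat_Suc fact_Suc)
qed

end

section \<open>Termination and the invariant at the output\<close>

lemma greedy_word_initial:
  assumes "0 < m"
  shows "greedy_word m [1..int m]"
proof
  have "[1..int m] \<in> permutations_of_set {1..int m}" by (auto simp: permutations_of_set_def)
  then show "pat m [1..int m] 0 = [1..int m]" by (simp add: pat_def red_permutation_id)
qed (use assms in auto)

lemma greedy_output_greedy_word: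
  assumes "0 < m"
  obtains w where "greedy_output (Suc m) = Some w" "greedy_word m w"
    "\<nexists>i. admissible (Suc m) w i"
proof -
  let ?b = "\<lambda>w. \<exists>i. admissible (Suc m) w i"
  have init: "greedy_word m [1..int (Suc m) - 1]"
    using greedy_word_initial[OF assms] by simp
  have "\<exists>w. while_option ?b (greedy_step (Suc m)) [1..int (Suc m) - 1] = Some w"
  proof (rule measure_while_option_Some[where P = "greedy_word m"
        and f = "\<lambda>w. fact (Suc m) + m + 1 - length w", OF _ init])
    fix w assume w: "greedy_word m w" "?b w"
    then have step: "greedy_word m (greedy_step (Suc m) w)"
      by (rule greedy_word.greedy_step_greedy_word)
    have "length (greedy_step (Suc m) w) = Suc (length w)"
      by (simp add: greedy_step_def Let_def append_letter_def)
    \<comment> \<open>Bounding the word after the step, not before it, makes the truncated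
      difference strictly decrease.\<close>
    moreover have "length (greedy_step (Suc m) w) - m \<le> fact (Suc m)"
      using greedy_word.k_le_fact[OF step] .
    ultimately show "greedy_word m (greedy_step (Suc m) w) \<and>
        fact (Suc m) + m + 1 - length (greedy_step (Suc m) w) < fact (Suc m) + m + 1 - length w"
      using step by (simp del: fact_Suc)
  qed
  then obtain w where w: "while_option ?b (greedy_step (Suc m)) [1..int (Suc m) - 1] = Some w"
    by blast
  show ?thesis
  proof (rule that)
    show "greedy_output (Suc m) = Some w" using w by (simp add: greedy_output_def)
    show "greedy_word m w"
      by (rule while_option_rule[where P = "greedy_word m", OF _ w init])
        (rule greedy_word.greedy_step_greedy_word)
    show "\<nexists>i. admissible (Suc m) w i" using while_option_stop[OF w] .
  qed
qed

section \<open>The final word\<close>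

text \<open>For a vertex, \<open>f\<close> lists its possible edges and \<open>E\<close> the edges
  used. By injectivity the visits counted are the size of the overlap, which is maximal exactly when
  every listed edge is used.\<close>

lemma card_filter_image:
  assumes "inj_on E A" "finite I" "inj_on f I"
    and P: "\<And>j. j \<in> A \<Longrightarrow> P j \<longleftrightarrow> E j \<in> f ` I"
  shows "card {j \<in> A. P j} \<le> card I"
    and "card {j \<in> A. P j} = card I \<longleftrightarrow> f ` I \<subseteq> E ` A"
proof -
  have "E ` {j \<in> A. P j} = E ` A \<inter> f ` I" using P by auto
  moreover have "inj_on E {j \<in> A. P j}" using assms(1) by (rule inj_on_subset) auto
  ultimately have 1: "card {j \<in> A. P j} = card (E ` A \<inter> f ` I)" by (metis card_image)
  have 2: "card (f ` I) = card I" using assms(3) by (rule card_image)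
  show "card {j \<in> A. P j} \<le> card I"
    unfolding 1 2[symmetric] using assms(2) by (intro card_mono) auto
  show "card {j \<in> A. P j} = card I \<longleftrightarrow> f ` I \<subseteq> E ` A"
    unfolding 1 2[symmetric] using assms(2)
    by (metis card_subset_eq finite_imageI inf.absorb_iff2 inf_le2)
qed

text \<open>Departures and arrivals of a walk at \<open>v\<close> differ only through its two
  ends.\<close>

lemma card_visits_balance:
  "card {j \<in> {..<k}. V j = v} + of_bool (V k = v)
   = card {j \<in> {..<k}. V (Suc j) = v} + of_bool (V (0::nat) = v)"
proof (induction k)
  case (Suc k)
  have "card {j \<in> {..<Suc k}. Q j} = card {j \<in> {..<k}. Q j} + of_bool (Q k)" for Q
  proof -
    have "{j \<in> {..<Suc k}. Q j} = (if Q k then insert k {j \<in> {..<k}. Q j} else {j \<in> {..<k}. Q j})"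
      by (auto simp: less_Suc_eq)
    then show ?thesis by simp
  qed
  then show ?case using Suc.IH by simp
qed simp

lemma sorted_drop_red:
  assumes "sorted (drop d x)"
  shows "sorted (drop d (red x))"
  unfolding sorted_iff_nth_mono
proof (intro allI impI)
  fix i j assume ij: "i \<le> j" "j < length (drop d (red x))"
  have "drop d x ! i \<le> drop d x ! j" using assms ij by (intro sorted_nth_mono) auto
  then show "drop d (red x) ! i \<le> drop d (red x) ! j"
    using ij red_nth_less_iff[of "d + j" x "d + i"] by (auto simp: not_less[symmetric])
qed

locale complete_greedy_word = greedy_word +
  assumes stuck: "\<nexists>i. admissible (Suc m) w i"
begin

abbreviation V :: "nat \<Rightarrow> int list" where "V \<equiv> pat m w"
abbreviation E :: "nat \<Rightarrow> int list" where "E \<equiv> pat (Suc m) w"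

definition ranks :: "int set" where "ranks = {1..int (Suc m)}"

lemma permutation_ranks:
  assumes "\<sigma> \<in> permutations_of_set {1..int (Suc m)}"
  shows "hd \<sigma> \<in> ranks" "last \<sigma> \<in> ranks"
proof -
  have "\<sigma> \<noteq> []" using length_permutation_int[OF assms] by auto
  then show "hd \<sigma> \<in> ranks" "last \<sigma> \<in> ranks"
    using hd_in_set[of \<sigma>] last_in_set[of \<sigma>] permutations_of_setD(1)[OF assms]
    unfolding ranks_def by auto
qed

lemma card_ranks: "finite ranks" "card ranks = Suc m"
  by (simp_all add: ranks_def)

lemma E_permutation: "j < k \<Longrightarrow> E j \<in> permutations_of_set {1..int (Suc m)}"
  using image_pat_permutations by blast

lemma E_snoc: "j < k \<Longrightarrow> E j = append_letter (last (E j)) (V j)"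
  using distinct_w by (intro pat_Suc_snoc) auto

lemma E_Cons: "j < k \<Longrightarrow> E j = hd (E j) # map (bump (hd (E j))) (V (Suc j))"
  using distinct_w by (intro pat_Suc_Cons) auto

section \<open>Degrees and the return to the start\<close>

definition out_full :: "int list \<Rightarrow> bool" where
  "out_full v \<longleftrightarrow> (\<lambda>i. append_letter i v) ` ranks \<subseteq> E ` {..<k}"

definition in_full :: "int list \<Rightarrow> bool" where
  "in_full v \<longleftrightarrow> (\<lambda>i. i # map (bump i) v) ` ranks \<subseteq> E ` {..<k}"

lemma out_degree:
  "card {j \<in> {..<k}. V j = v} = Suc m \<longleftrightarrow> out_full v"
proof -
  have "V j = v \<longleftrightarrow> E j \<in> (\<lambda>i. append_letter i v) ` ranks" if "j \<in> {..<k}" for j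
    using that E_snoc[of j] permutation_ranks(2)[OF E_permutation[of j]] append_letter_inject
    by (smt (verit) imageE image_eqI lessThan_iff)
  from card_filter_image(2)[OF inj card_ranks(1) _ this] show ?thesis
    unfolding out_full_def by (simp add: card_ranks inj_on_def append_letter_inject)
qed

lemma in_degree:
  "card {j \<in> {..<k}. V (Suc j) = v} \<le> Suc m"
  "card {j \<in> {..<k}. V (Suc j) = v} = Suc m \<longleftrightarrow> in_full v"
proof -
  have *: "V (Suc j) = v \<longleftrightarrow> E j \<in> (\<lambda>i. i # map (bump i) v) ` ranks" if "j \<in> {..<k}" for j
    using that E_Cons[of j] permutation_ranks(1)[OF E_permutation[of j]] Cons_map_bump_inject
    by (smt (verit) imageE image_eqI lessThan_iff)
  have "inj_on (\<lambda>i. i # map (bump i) v) ranks" by (simp add: inj_on_def)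
  from card_filter_image[OF inj card_ranks(1) this *]
  show "card {j \<in> {..<k}. V (Suc j) = v} \<le> Suc m"
    "card {j \<in> {..<k}. V (Suc j) = v} = Suc m \<longleftrightarrow> in_full v"
    unfolding in_full_def by (simp_all add: card_ranks)
qed

lemma out_full_end: "out_full (V k)"
proof -
  have "append_letter i (V k) \<in> E ` {..<k}" if "i \<in> ranks" for i
    using stuck[unfolded admissible_iff, simplified, rule_format, of "nat i"] that
    by (auto simp: ranks_def)
  then show ?thesis by (auto simp: out_full_def)
qed

text \<open>All edges out of the final vertex are used. Were it different from the start, it would
  have one more arrival than departures, exceeding its in-degree.\<close>

lemma end_eq_start: "V k = V 0"
proof (rule ccontr)
  assume "V k \<noteq> V 0"
  then have "Suc (card {j \<in> {..<k}. V j = V k}) = card {j \<in> {..<k}. V (Suc j) = V k}"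
    using card_visits_balance[of k V "V k"] by simp
  then show False using in_degree(1)[of "V k"] out_degree[of "V k"] out_full_end by simp
qed

text \<open>The walk is closed, so arrivals and departures agree at each vertex, and both kinds of
  fullness mean the count \<open>Suc m\<close>.\<close>

lemma in_full_iff_out_full: "in_full v \<longleftrightarrow> out_full v"
  using card_visits_balance[of k V v] end_eq_start in_degree(2)[of v] out_degree[of v] by simp

section \<open>Every edge is used\<close>

lemma out_full_if_max_used:
  assumes "append_letter (int (Suc m)) v \<in> E ` {..<k}"
  shows "out_full v"
proof -
  obtain j where j: "j < k" "E j = append_letter (int (Suc m)) v" using assms by auto
  then have V: "V j = v" "last (E j) = int (Suc m)"
    using E_snoc[of j] append_letter_inject by metis+
  \<comment> \<open>Taking the largest label at time \<open>j\<close> means that all smaller labels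
    at \<open>v\<close> were used before.\<close>
  have "append_letter i v \<in> E ` {..<k}" if "i \<in> ranks" for i
  proof (cases "i = int (Suc m)")
    case False
    then have "append_letter i (V j) \<in> E ` {..<j}"
      using that V j by (intro greedy) (auto simp: ranks_def)
    then show ?thesis using V j by auto
  qed (use assms in simp)
  then show ?thesis by (auto simp: out_full_def)
qed

text \<open>The word \<open>v @ [int (Suc m)]\<close> is both the maximal-label edge out of
  \<open>v\<close> and an edge into the successor. If the successor is full, this edge is used, and
  then \<open>v\<close> is full as well.\<close>

lemma in_full_if_max_successor:
  assumes v: "v \<in> permutations_of_set {1..int m}"
    and full: "in_full (red (tl v @ [int (Suc m)]))"
  shows "in_full v"
proof -
  let ?\<sigma> = "v @ [int (Suc m)]"
  have sv: "set v = {1..int m}" "distinct v" using v by (auto dest: permutations_of_setD)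
  have "length v = m" using v by (rule length_permutation_int)
  then have ne: "v \<noteq> []" using m_pos by auto
  have \<sigma>: "?\<sigma> \<in> permutations_of_set {1..int (Suc m)}"
  proof (rule permutations_of_setI)
    have "{1..int (Suc m)} = insert (int (Suc m)) {1..int m}" by auto
    then show "set ?\<sigma> = {1..int (Suc m)}" using sv(1) by simp
    show "distinct ?\<sigma>" using sv by simp
  qed
  have \<sigma>_Cons: "?\<sigma> = hd v # (tl v @ [int (Suc m)])" using ne by simp
  have "distinct (hd v # (tl v @ [int (Suc m)]))"
    using permutations_of_setD(2)[OF \<sigma>] \<sigma>_Cons by metis
  note red_Cons[OF this, unfolded Let_def, folded \<sigma>_Cons]
  then obtain c where c: "red ?\<sigma> = c # map (bump c) (red (tl v @ [int (Suc m)]))" by blast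
  have red\<sigma>: "red ?\<sigma> = ?\<sigma>" using \<sigma> by (rule red_permutation_id)
  then have "hd ?\<sigma> = c" using c by (metis list.sel(1))
  then have "c \<in> ranks" using permutation_ranks(1)[OF \<sigma>] by simp
  then have "red ?\<sigma> \<in> (\<lambda>i. i # map (bump i) (red (tl v @ [int (Suc m)]))) ` ranks"
    unfolding c by (rule imageI)
  then have "?\<sigma> \<in> E ` {..<k}" using full unfolding red\<sigma> in_full_def by (rule rev_subsetD)
  moreover have "append_letter (int (Suc m)) v = ?\<sigma>"
    using sv by (intro append_letter_above) auto
  ultimately show ?thesis using out_full_if_max_used in_full_iff_out_full by simp
qed

text \<open>Appending maxima leads from every vertex to the increasing one; fullness propagates backwards
  along this path.\<close>

lemma in_full_if_sorted_drop:
  assumes "v \<in> permutations_of_set {1..int m}" "sorted (drop d v)"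
  shows "in_full v"
  using assms
\<comment> \<open>\<open>d\<close> bounds the leading letters outside the sorted suffix. Passing to
  the successor drops the first letter and appends a maximum, so \<open>d\<close> falls by
  one.\<close>
proof (induction d arbitrary: v)
  case 0
  then have "v = [1..int m]"
    by (intro sorted_distinct_set_unique) (auto dest: permutations_of_setD)
  then show ?case using out_full_end end_eq_start start in_full_iff_out_full by simp
next
  case (Suc d)
  let ?x = "tl v @ [int (Suc m)]"
  have sv: "set v = {1..int m}" "distinct v" using Suc.prems by (auto dest: permutations_of_setD)
  have len: "length v = m" using Suc.prems by (simp add: length_permutation_int)
  have tl: "set (tl v) \<subseteq> {1..int m}" using sv by (metis list.set_sel(2) list.sel(2) subsetI)
  have "distinct ?x" using tl sv by (auto simp: distinct_tl)
  then have "red ?x \<in> permutations_of_set {1..int m}"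
    using red_permutation[of ?x] len m_pos by simp
  moreover have "sorted (drop d ?x)"
  proof -
    have "sorted (drop d (tl v))" using Suc.prems by (simp add: drop_Suc)
    moreover have "x \<le> int (Suc m)" if "x \<in> set (drop d (tl v))" for x
      using that tl by (force dest: in_set_dropD)
    ultimately show ?thesis by (auto simp: sorted_append dest: in_set_dropD)
  qed
  ultimately have "in_full (red ?x)" by (intro Suc.IH sorted_drop_red)
  then show ?case using Suc.prems(1) in_full_if_max_successor by blast
qed

lemma image_E: "E ` {..<k} = permutations_of_set {1..int (Suc m)}"
proof (intro equalityI image_pat_permutations subsetI)
  fix \<sigma> assume \<sigma>: "\<sigma> \<in> permutations_of_set {1..int (Suc m)}"
  have len: "length \<sigma> = Suc m" using \<sigma> by (rule length_permutation_int)
  have d: "distinct \<sigma>" using \<sigma> by (rule permutations_of_setD)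
  have "pat (Suc m) \<sigma> 0 = \<sigma>" using red_permutation_id[OF \<sigma>] len by (simp add: pat_def)
  then have eq: "\<sigma> = append_letter (last \<sigma>) (pat m \<sigma> 0)"
    using pat_Suc_snoc[OF d, of 0 m] len by simp
  have "in_full (pat m \<sigma> 0)"
    using pat_permutation[OF d, of 0 m] len
    \<comment> \<open>A vertex has length \<open>m\<close>, so the suffix after \<open>m\<close>
      letters is empty and sorted.\<close>
    by (intro in_full_if_sorted_drop[where d = m]) (auto simp: pat_def)
  then have "out_full (pat m \<sigma> 0)" using in_full_iff_out_full by simp
  then show "\<sigma> \<in> E ` {..<k}"
    using eq permutation_ranks(2)[OF \<sigma>] unfolding out_full_def by auto
qed

section \<open>Length of the walk, its final steps and the cyclic closure\<close>

lemma k_eq_fact: "k = fact (Suc m)"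
proof -
  have "k = card (E ` {..<k})" using card_image[OF inj] by simp
  also have "\<dots> = fact (card {1..int (Suc m)})"
    unfolding image_E by (rule card_permutations_of_set) simp
  also have "card {1..int (Suc m)} = Suc m" by simp
  finally show ?thesis .
qed

lemma k_ge: "2 * m \<le> k"
proof -
  \<comment> \<open>The bound separates the first \<open>m\<close> letters from the positions where
    wrapping windows begin, so that \<open>below\<close> applies there.\<close>
  have "2 * m \<le> Suc m * m" using m_pos by simp
  also have "\<dots> \<le> Suc m * fact m" using fact_ge_self by (intro mult_le_mono2) auto
  finally show ?thesis using k_eq_fact by simp
qed

text \<open>The maximal-label edge at this vertex is used at some time. If that were before the last
  exit, all smaller labels would have been used earlier still, including the label of the last exit
  itself.\<close>

lemma last_exit_max:
  assumes "j < k" and later: "\<And>j'. \<lbrakk>j < j'; j' < k\<rbrakk> \<Longrightarrow> V j' \<noteq> V j"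
  shows "last (E j) = int (Suc m)"
proof (rule ccontr)
  assume neq: "last (E j) \<noteq> int (Suc m)"
  have "V j \<in> permutations_of_set {1..int m}"
    using assms distinct_w by (intro pat_permutation) auto
  then have "in_full (V j)"
    by (rule in_full_if_sorted_drop[where d = m]) (use length_permutation_int in \<open>simp add: pat_def\<close>)
  then have "append_letter (int (Suc m)) (V j) \<in> E ` {..<k}"
    unfolding in_full_iff_out_full by (auto simp: out_full_def ranks_def)
  then obtain j0 where j0: "j0 < k" "E j0 = append_letter (int (Suc m)) (V j)" by auto
  then have V: "V j0 = V j" "last (E j0) = int (Suc m)"
    using E_snoc[of j0] append_letter_inject by metis+
  have "j0 < j" using V neq later[of j0] j0 by (metis linorder_neqE_nat)
  have "last (E j) \<in> ranks" using permutation_ranks(2)[OF E_permutation[OF assms(1)]] .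
  then have "append_letter (last (E j)) (V j0) \<in> E ` {..<j0}"
    using neq V j0 by (intro greedy) (auto simp: ranks_def)
  then obtain j' where j': "j' < j0" "E j' = E j"
    using E_snoc[OF assms(1)] V by auto
  then have "j' = j" using inj_onD[OF inj, of j' j] \<open>j0 < j\<close> assms by auto
  then show False using j' \<open>j0 < j\<close> by simp
qed

text \<open>The last exit from the start vertex carries the maximal label, so it is the increasing
  edge. This edge is a loop: the walk is back at the start vertex and never leaves it again, hence
  the step is the final one.\<close>

lemma E_last: "E (k - 1) = [1..int (Suc m)]"
proof -
  let ?J = "{j. j < k \<and> V j = V 0}"
  define j where "j = Max ?J"
  have k0: "0 < k" using k_ge m_pos by simp
  then have "?J \<noteq> {}" by blast
  then have "j \<in> ?J" unfolding j_def by (intro Max_in) auto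
  then have j: "j < k" "V j = V 0" by auto
  have later: "V j' \<noteq> V 0" if "j < j'" "j' < k" for j'
    using Max_ge[of ?J j'] that unfolding j_def by fastforce
  have "last (E j) = int (Suc m)" using j later by (intro last_exit_max) auto
  then have "E j = append_letter (int (Suc m)) [1..int m]"
    using E_snoc[OF j(1)] j(2) start by simp
  also have "\<dots> = [1..int m] @ [int (Suc m)]" by (intro append_letter_above) auto
  also have "\<dots> = [1..int (Suc m)]" using upto_rec2[of 1 "int (Suc m)"] by simp
  finally have E: "E j = [1..int (Suc m)]" .
  have "[1..int (Suc m)] = 1 # map (bump 1) [1..int m]"
    by (rule nth_equalityI) (auto simp: nth_upto bump_def nth_Cons split: nat.split)
  then have "V (Suc j) = V 0"
    using E_Cons[OF j(1)] E Cons_map_bump_inject start by metis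
  then have "\<not> Suc j < k" using later[of "Suc j"] by auto
  then have "k - 1 = j" using j by simp
  then show ?thesis using E by simp
qed

lemma tail_increasing:
  assumes "k - 1 \<le> p" "p < q" "q < length w"
  shows "w ! p < w ! q"
proof -
  have k0: "0 < k" using k_ge m_pos by simp
  have "w ! (k - 1 + (p - (k - 1))) < w ! (k - 1 + (q - (k - 1)))"
  proof (rule pat_upto_increasing[OF E_last])
    show "k - 1 + Suc m \<le> length w" using k0 by simp
    show "p - (k - 1) < q - (k - 1)" using assms by (intro diff_less_mono)
    show "q - (k - 1) < Suc m" using assms k0 by linarith
  qed
  then show ?thesis using assms by simp
qed

text \<open>With an ascent here, the window at \<open>k - 2\<close> would be increasing too, and the
  edge \<open>E (k - 1)\<close> would occur twice.\<close>

lemma descent_before_tail: "\<not> w ! (k - 2) < w ! (k - 1)"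
proof
  assume asc: "w ! (k - 2) < w ! (k - 1)"
  have k2: "2 \<le> k" using k_ge m_pos by linarith
  have inc: "w ! p < w ! q" if "k - 2 \<le> p" "p < q" "q < length w" for p q
  proof (cases "p = k - 2")
    case True
    show ?thesis
    proof (cases "q = k - 1")
      case False
      then have "w ! (k - 1) < w ! q" using True that by (intro tail_increasing) auto
      then show ?thesis using asc True by simp
    qed (use asc True in simp)
  next
    case False
    then show ?thesis using that by (intro tail_increasing) auto
  qed
  have "E (k - 2) = E (k - 1)"
    unfolding pat_def
  proof (rule red_eqI)
    fix s t assume st: "s < t" "t < length (take (Suc m) (drop (k - 2) w))"
    then have "w ! (k - 2 + s) < w ! (k - 2 + t)" "w ! (k - 1 + s) < w ! (k - 1 + t)"
      using k2 by (auto intro!: inc)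
    then show "take (Suc m) (drop (k - 2) w) ! s < take (Suc m) (drop (k - 2) w) ! t
      \<longleftrightarrow> take (Suc m) (drop (k - 1) w) ! s < take (Suc m) (drop (k - 1) w) ! t"
      using st k2 by simp
  qed (use distinct_w k2 in auto)
  then have "k - 2 = k - 1" using inj_onD[OF inj, of "k - 2" "k - 1"] k2 by simp
  then show False using k2 by simp
qed

text \<open>The descent from \<open>k - 2\<close> to \<open>k - 1\<close> sits at offsets
  \<open>s - 2\<close> and \<open>s - 1\<close> of the window at \<open>k - s\<close>. Later windows
  have an ascent there, so this visit to its vertex is the last. For \<open>s = 1\<close> no later
  departure exists.\<close>

lemma last_exits_max:
  assumes "1 \<le> s" "s \<le> m"
  shows "last (E (k - s)) = int (Suc m)"
proof (rule last_exit_max)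
  show "k - s < k" using assms k_ge m_pos by linarith
  fix j' assume j': "k - s < j'" "j' < k"
  show "V j' \<noteq> V (k - s)"
  proof
    assume "V j' = V (k - s)"
    then have "w ! (j' + (s - 2)) < w ! (j' + (s - 1)) \<longleftrightarrow> w ! (k - s + (s - 2)) < w ! (k - s + (s - 1))"
      using assms j' by (intro pat_eq_nth_less_iff) auto
    moreover have "k - s + (s - 2) = k - 2" "k - s + (s - 1) = k - 1"
      using assms j' k_ge by auto
    moreover have "w ! (j' + (s - 2)) < w ! (j' + (s - 1))"
      using assms j' by (intro tail_increasing) auto
    ultimately show False using descent_before_tail by metis
  qed
qed

lemma tail_window_max:
  assumes "k \<le> q" "q < length w" "p < q" "q \<le> p + m"
  shows "w ! p < w ! q"
proof -
  \<comment> \<open>With this \<open>s\<close>, the window of length \<open>Suc m\<close> ending at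
    \<open>q\<close> starts at \<open>k - s\<close>.\<close>
  define s where "s = length w - q"
  have s: "1 \<le> s" "s \<le> m" "k - s + m = q" using assms k_ge by (auto simp: s_def)
  let ?j = "k - s"
  have jk: "?j < k" using s k_ge by linarith
  have len: "length (E ?j) = Suc m" using length_permutation_int[OF E_permutation[OF jk]] .
  have Em: "E ?j ! m = int (Suc m)"
    using last_exits_max[OF s(1,2)] len by (metis diff_Suc_1 last_conv_nth length_0_conv nat.distinct(1))
  have pj: "p - ?j < m" "?j + (p - ?j) = p" using assms s by auto
  have "E ?j ! (p - ?j) \<in> {1..int (Suc m)}"
    using permutations_of_setD(1)[OF E_permutation[OF jk]] len pj nth_mem[of "p - ?j" "E ?j"] by auto
  moreover have "E ?j ! (p - ?j) \<noteq> E ?j ! m"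
    using permutations_of_setD(2)[OF E_permutation[OF jk]] len pj by (simp add: nth_eq_iff_index_eq)
  ultimately have "E ?j ! (p - ?j) < E ?j ! m" using Em by simp
  moreover have "?j + Suc m \<le> length w" using jk by linarith
  ultimately have "w ! (?j + (p - ?j)) < w ! (?j + m)"
    using pat_nth_less_iff[of ?j "Suc m" w "p - ?j" m] pj(1) by simp
  then show ?thesis unfolding pj(2) s(3) .
qed

text \<open>Wrapping around replaces the last \<open>m\<close> letters of \<open>w\<close> by the
  first \<open>m\<close>. In either version each letter from position \<open>k\<close> on exceeds
  the earlier letters of its window, so the pattern is unchanged.\<close>

lemma red_cyclic_factor:
  assumes j: "j < k"
  shows "red (cyclic_factor (Suc m) (red (take k w)) j) = E j"
  unfolding pat_def
proof (rule red_eqI)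
  let ?u = "cyclic_factor (Suc m) (red (take k w)) j"
  have mk: "m < k" using k_ge m_pos by linarith
  show "length ?u = length (take (Suc m) (drop j w))"
    using j by (simp add: cyclic_factor_def)
  have u_nth: "?u ! t = red (take k w) ! ((j + t) mod k)" if "t \<le> m" for t
    using that by (simp add: cyclic_factor_def del: upt_Suc)
  have modk: "(j + t) mod k = (if j + t < k then j + t else j + t - k)" if "t \<le> m" for t
    using that j mk by (simp add: mod_if)
  have d: "distinct (red (take k w))"
    using red_permutation[of "take k w"] distinct_w by (auto dest: permutations_of_setD)
  have "inj_on (\<lambda>t. (j + t) mod k) {0..<Suc m}"
  proof (rule inj_onI)
    fix s t assume "s \<in> {0..<Suc m}" "t \<in> {0..<Suc m}" "(j + s) mod k = (j + t) mod k"
    then have "s \<le> m" "t \<le> m"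
      "(if j + s < k then j + s else j + s - k) = (if j + t < k then j + t else j + t - k)"
      using modk by auto
    then show "s = t" using mk j by (simp only: split: if_splits)
  qed
  then show "distinct ?u"
    using d mk by (auto simp: cyclic_factor_def distinct_map inj_on_def nth_eq_iff_index_eq
        simp del: upt_Suc)
  show "distinct (take (Suc m) (drop j w))" using distinct_w by simp
  fix s t assume st: "s < t" "t < length ?u"
  then have t: "t \<le> m" by (simp add: cyclic_factor_def)
  have "?u ! s < ?u ! t \<longleftrightarrow> w ! ((j + s) mod k) < w ! ((j + t) mod k)"
    using red_nth_less_iff[of "(j + s) mod k" "take k w" "(j + t) mod k"] mk u_nth st t by simp
  also have "\<dots> \<longleftrightarrow> w ! (j + s) < w ! (j + t)"
  proof (cases "j + t < k")
    case True
    then show ?thesis using modk st t by simp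
  next
    case wrap: False
    have "w ! (j + s) < w ! (j + t)"
      using wrap st t j by (intro tail_window_max) auto
    moreover have "w ! ((j + s) mod k) < w ! ((j + t) mod k)"
    \<comment> \<open>Either only the later position wraps, and \<open>below\<close> puts the other
      letter under \<open>w ! 0\<close>, or both wrap into the increasing start.\<close>
    proof (cases "j + s < k")
      case True
      have "w ! (j + s) < w ! 0"
        using wrap t k_ge True by (intro below) auto
      also have "w ! 0 \<le> w ! (j + t - k)"
      proof (cases "j + t - k = 0")
        case False
        moreover have "j + t - k < m" using t j wrap by linarith
        ultimately show ?thesis using start_increasing[of 0 "j + t - k"] by simp
      qed simp
      finally show ?thesis using modk[of s] modk[of t] st t wrap True by simp
    next
      case False
      then have "w ! (j + s - k) < w ! (j + t - k)"
        using st t j by (intro start_increasing) auto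
      then show ?thesis using modk[of s] modk[of t] st t wrap False by simp
    qed
    ultimately show ?thesis by simp
  qed
  also have "\<dots> \<longleftrightarrow> take (Suc m) (drop j w) ! s < take (Suc m) (drop j w) ! t"
    using st t j by simp
  finally show "?u ! s < ?u ! t \<longleftrightarrow> take (Suc m) (drop j w) ! s < take (Suc m) (drop j w) ! t" .
qed

lemma universal_cycle_word: "universal_cycle (Suc m) (cycle_word (Suc m) w)"
  unfolding universal_cycle_def
proof
  fix \<sigma> assume "\<sigma> \<in> permutations_of_set {1..int (Suc m)}"
  then obtain j where j: "j < k" "E j = \<sigma>" unfolding image_E[symmetric] by auto
  have cw: "cycle_word (Suc m) w = red (take k w)" by (simp add: cycle_word_def)
  show "\<exists>!j. j < length (cycle_word (Suc m) w) \<and>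
      red (cyclic_factor (Suc m) (cycle_word (Suc m) w) j) = \<sigma>"
  proof (rule ex1I[of _ j])
    show "j < length (cycle_word (Suc m) w) \<and>
        red (cyclic_factor (Suc m) (cycle_word (Suc m) w) j) = \<sigma>"
      using j by (simp add: cw red_cyclic_factor)
    fix j' assume "j' < length (cycle_word (Suc m) w) \<and>
        red (cyclic_factor (Suc m) (cycle_word (Suc m) w) j') = \<sigma>"
    then have "j' < k" "E j' = \<sigma>" by (auto simp: cw red_cyclic_factor)
    then show "j' = j" using j inj_onD[OF inj, of j' j] by simp
  qed
qed

end

theorem theorem2p4:
  fixes n :: nat
  assumes "n \<ge> 2"
  shows "\<exists>w. greedy_output n = Some w \<and> universal_cycle n (cycle_word n w)"
proof -
  obtain m where m: "n = Suc m" "0 < m" using assms by (cases n) auto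
  obtain w where w: "greedy_output (Suc m) = Some w" "greedy_word m w"
    "\<nexists>i. admissible (Suc m) w i"
    using greedy_output_greedy_word[OF m(2)] .
  interpret complete_greedy_word m w
    using w by (simp add: complete_greedy_word_def complete_greedy_word_axioms_def)
  show ?thesis using w universal_cycle_word m by auto
qed

end
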